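(* Let $W$ be a right-angled Coxeter group and $u,v\in W$. Then the map \[ \phi:\mathrm{conv}(\mathrm{id},u,v)\to[\mathrm{id},u]_R\times[\mathrm{id},v]_R,\qquad x\mapsto(x\wedge_R u,\;x\wedge_R v) \] is well defined and injective.
   Context: A Coxeter group $W$ with simple generators $S$ and Coxeter matrix $(m_{ij})$ is right-angled if all $m_{ij}\in\{1,2,\infty\}$. The right weak order $\le_R$ on $W$ is generated by the covers $w\lessdot_R ws$ for $s\in S$ with $\ell(ws)=\ell(w)+1$ ($\ell$ the length with respect to $S$); it is a meet-semilattice with meet $\wedge_R$, and $[\mathrm{id},u]_R$ denotes the interval $\{x:\mathrm{id}\le_R x\le_R u\}$. $\mathrm{conv}(X)$ denotes the convex hull of $X$ in the Cayley graph of $(W,S)$ (vertices $W$, $x$ adjacent to $xs$, $s\in S$): a vertex set $C$ is convex if $a,b\in C$ and $d(a,c)+d(c,b)=d(a,b)$ imply $c\in C$, with $d$ the graph distance, and $\mathrm{conv}(X)$ is the intersection of all convex sets containing $X$. *)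

theory Defs
  imports "HOL-Algebra.Algebra" "HOL-Library.Extended_Nat" HOL.Hull
begin

definition coxeter_matrix :: "'a set \<Rightarrow> ('a \<Rightarrow> 'a \<Rightarrow> enat) \<Rightarrow> bool" where
  "coxeter_matrix S m \<longleftrightarrow>
     (\<forall>s\<in>S. m s s = 1) \<and>
     (\<forall>s\<in>S. \<forall>t\<in>S. m s t = m t s) \<and>
     (\<forall>s\<in>S. \<forall>t\<in>S. s \<noteq> t \<longrightarrow> 2 \<le> m s t)"

text \<open>
  The congruence on the free monoid over \<open>S\<close> generated by the relations
  \<open>(s t)^{m s t} = 1\<close> for \<open>m s t < \<infinity>\<close>. Since \<open>m s s = 1\<close>, these include \<open>s s = 1\<close>, so formal
  inverses are not needed and the quotient monoid is the group with this presentation.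
\<close>

inductive coxeter_cong :: "'a set \<Rightarrow> ('a \<Rightarrow> 'a \<Rightarrow> enat) \<Rightarrow> 'a list \<Rightarrow> 'a list \<Rightarrow> bool"
  for S :: "'a set" and m :: "'a \<Rightarrow> 'a \<Rightarrow> enat" where
  relation: "s \<in> S \<Longrightarrow> t \<in> S \<Longrightarrow> m s t = enat k
      \<Longrightarrow> coxeter_cong S m (concat (replicate k [s, t])) []"
| refl: "w \<in> lists S \<Longrightarrow> coxeter_cong S m w w"
| sym: "coxeter_cong S m v w \<Longrightarrow> coxeter_cong S m w v"
| trans: "coxeter_cong S m u v \<Longrightarrow> coxeter_cong S m v w \<Longrightarrow> coxeter_cong S m u w"
| append: "coxeter_cong S m v w \<Longrightarrow> coxeter_cong S m v' w'
      \<Longrightarrow> coxeter_cong S m (v @ v') (w @ w')"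

definition word_val :: "('a, 'b) monoid_scheme \<Rightarrow> 'a list \<Rightarrow> 'a" where
  "word_val G w = foldr (\<otimes>\<^bsub>G\<^esub>) w \<one>\<^bsub>G\<^esub>"

text \<open>
  \<open>G\<close> is a Coxeter group with simple generators \<open>S\<close> and Coxeter matrix \<open>m\<close>, i.e.\ evaluation of
  words induces an isomorphism from the presented group onto \<open>G\<close>. The set \<open>S\<close> may be infinite.
\<close>

locale coxeter_system = group G
  for G :: "('a, 'b) monoid_scheme" (structure) and S :: "'a set" and m :: "'a \<Rightarrow> 'a \<Rightarrow> enat" +
  assumes generators_closed: "S \<subseteq> carrier G"
    and generators_generate: "generate G S = carrier G"
    and matrix: "coxeter_matrix S m"
    and presentation: "v \<in> lists S \<Longrightarrow> w \<in> lists S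
      \<Longrightarrow> word_val G v = word_val G w \<longleftrightarrow> coxeter_cong S m v w"

definition right_angled :: "'a set \<Rightarrow> ('a \<Rightarrow> 'a \<Rightarrow> enat) \<Rightarrow> bool" where
  "right_angled S m \<longleftrightarrow> (\<forall>s\<in>S. \<forall>t\<in>S. m s t \<in> {1, 2, \<infinity>})"

definition cox_length :: "('a, 'b) monoid_scheme \<Rightarrow> 'a set \<Rightarrow> 'a \<Rightarrow> nat" where
  "cox_length G S x = (LEAST n. \<exists>w\<in>lists S. length w = n \<and> word_val G w = x)"

definition right_weak_cover :: "('a, 'b) monoid_scheme \<Rightarrow> 'a set \<Rightarrow> 'a \<Rightarrow> 'a \<Rightarrow> bool" where
  "right_weak_cover G S w x \<longleftrightarrow>
     w \<in> carrier G \<and> (\<exists>s\<in>S. x = w \<otimes>\<^bsub>G\<^esub> s \<and> cox_length G S x = cox_length G S w + 1)"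

definition right_weak_order :: "('a, 'b) monoid_scheme \<Rightarrow> 'a set \<Rightarrow> 'a gorder" where
  "right_weak_order G S =
     \<lparr>carrier = carrier G, eq = (=), le = (right_weak_cover G S)\<^sup>*\<^sup>*\<rparr>"

definition cayley_adj :: "('a, 'b) monoid_scheme \<Rightarrow> 'a set \<Rightarrow> 'a \<Rightarrow> 'a \<Rightarrow> bool" where
  "cayley_adj G S x y \<longleftrightarrow> x \<in> carrier G \<and> (\<exists>s\<in>S. y = x \<otimes>\<^bsub>G\<^esub> s)"

text \<open>
  The length of a shortest walk. It is only meaningful for \<open>x\<close>, \<open>y\<close> in the same component, which
  is no restriction for vertices of the Cayley graph of a group with respect to generators.
\<close>

definition cayley_dist :: "('a, 'b) monoid_scheme \<Rightarrow> 'a set \<Rightarrow> 'a \<Rightarrow> 'a \<Rightarrow> nat" where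
  "cayley_dist G S x y = (LEAST n. (cayley_adj G S ^^ n) x y)"

definition cayley_convex :: "('a, 'b) monoid_scheme \<Rightarrow> 'a set \<Rightarrow> 'a set \<Rightarrow> bool" where
  "cayley_convex G S C \<longleftrightarrow> C \<subseteq> carrier G \<and>
     (\<forall>a\<in>C. \<forall>b\<in>C. \<forall>c\<in>carrier G.
        cayley_dist G S a c + cayley_dist G S c b = cayley_dist G S a b \<longrightarrow> c \<in> C)"

definition cayley_conv :: "('a, 'b) monoid_scheme \<Rightarrow> 'a set \<Rightarrow> 'a set \<Rightarrow> 'a set" where
  "cayley_conv G S A = cayley_convex G S hull A"

definition meet_pair ::
    "('a, 'b) monoid_scheme \<Rightarrow> 'a set \<Rightarrow> 'a \<Rightarrow> 'a \<Rightarrow> 'a \<Rightarrow> 'a \<times> 'a" where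
  "meet_pair G S u v x =
     (x \<sqinter>\<^bsub>right_weak_order G S\<^esub> u, x \<sqinter>\<^bsub>right_weak_order G S\<^esub> v)"

end

theory Submission
  imports Defs
begin

text \<open>
  Send \<open>x\<close> to its set \<open>N(x)\<close> of inversions, the reflections \<open>t\<close> with \<open>\<ell>(t x) < \<ell>(x)\<close>.
  Graph distance becomes the cardinality of the symmetric difference and the right weak order
  becomes inclusion, so each set \<open>{x. t \<notin> N(x)}\<close> is convex and \<open>N(x) \<subseteq> N(u) \<union> N(v)\<close> on
  \<open>conv(id, u, v)\<close>. In the right-angled case, crossing walls are perpendicular. Hence two
  elements with a common inversion have a common left descent, namely any left descent of a
  shortest element having that inversion: if another element with the inversion lacked that
  descent, the two walls would cross, so the descent could be removed from the shortest element.
  This yields meets with \<open>N(x \<and> u) = N(x) \<inter> N(u)\<close>, and then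
  \<open>N(x) = N(x \<and> u) \<union> N(x \<and> v)\<close> recovers \<open>x\<close>.
\<close>

section \<open>Alternating words and the infinite dihedral group\<close>

fun alternating :: "'a \<Rightarrow> 'a \<Rightarrow> nat \<Rightarrow> 'a list" where
  "alternating a b 0 = []"
| "alternating a b (Suc k) = a # alternating b a k"

lemma length_alternating [simp]: "length (alternating a b k) = k"
  by (induction k arbitrary: a b) auto

lemma set_alternating: "set (alternating a b k) \<subseteq> {a, b}"
  by (induction k arbitrary: a b) fastforce+

text \<open>
  The infinite dihedral group acting on its chambers, labelled by the integers: \<open>a\<close> and \<open>b\<close>
  reflect in the two walls of chamber \<open>0\<close>, and all other letters act trivially.
\<close>

fun dihedral_act :: "'a \<Rightarrow> 'a \<Rightarrow> 'a list \<Rightarrow> int \<Rightarrow> int" where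
  "dihedral_act a b [] n = n"
| "dihedral_act a b (c # w) n =
     (if c = a then - 1 - dihedral_act a b w n
      else if c = b then 1 - dihedral_act a b w n
      else dihedral_act a b w n)"

lemma dihedral_act_append:
  "dihedral_act a b (v @ w) n = dihedral_act a b v (dihedral_act a b w n)"
  by (induction v) auto

text \<open>Used to bound lengths from below: a word carrying chamber \<open>0\<close> to chamber
  \<open>n\<close> needs at least |n| letters.\<close>

lemma dihedral_act_abs_le: "\<bar>dihedral_act a b w n\<bar> \<le> \<bar>n\<bar> + int (length w)"
  by (induction w) auto

lemma dihedral_act_alternating:
  assumes "a \<noteq> b"
  shows "dihedral_act a b (alternating a b k) 0 = - int k"
    and "dihedral_act a b (alternating b a k) 0 = int k"
  using assms by (induction k) auto

section \<open>Words, generators and length\<close>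

locale right_angled_coxeter_system = coxeter_system +
  assumes right_angled: "right_angled S m"
begin

lemma word_val_Nil [simp]: "word_val G [] = \<one>"
  by (simp add: word_val_def)

lemma word_val_Cons [simp]: "word_val G (s # w) = s \<otimes> word_val G w"
  by (simp add: word_val_def)

lemma gen_closed [simp, intro]: "s \<in> S \<Longrightarrow> s \<in> carrier G"
  using generators_closed by blast

lemma word_val_closed [simp, intro]: "w \<in> lists S \<Longrightarrow> word_val G w \<in> carrier G"
  by (induction w) auto

lemma word_val_append:
  "v \<in> lists S \<Longrightarrow> w \<in> lists S \<Longrightarrow> word_val G (v @ w) = word_val G v \<otimes> word_val G w"
  by (induction v) (auto simp: m_assoc)

lemma coxeter_cong_lists: "coxeter_cong S m v w \<Longrightarrow> v \<in> lists S \<and> w \<in> lists S"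
  by (induction rule: coxeter_cong.induct) (auto simp: in_lists_conv_set)

lemma coxeter_cong_word_val: "coxeter_cong S m v w \<Longrightarrow> word_val G v = word_val G w"
  using presentation coxeter_cong_lists by blast

lemma gen_square [simp]:
  assumes "s \<in> S" shows "s \<otimes> s = \<one>"
proof -
  have "m s s = enat 1"
    using matrix assms by (auto simp: coxeter_matrix_def one_enat_def)
  from coxeter_cong.relation[where S = S and m = m, OF assms assms this]
  have "word_val G [s, s] = word_val G []"
    by (intro coxeter_cong_word_val) simp
  thus ?thesis using assms by simp
qed

lemma gen_inv [simp]: "s \<in> S \<Longrightarrow> inv s = s"
  by (simp add: inv_equality)

lemma gen_cancel [simp]: "s \<in> S \<Longrightarrow> x \<in> carrier G \<Longrightarrow> s \<otimes> (s \<otimes> x) = x"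
  by (simp flip: m_assoc)

lemma gen_commute:
  assumes "s \<in> S" "t \<in> S" "m s t = enat 2" shows "s \<otimes> t = t \<otimes> s"
proof -
  from coxeter_cong.relation[where S = S and m = m, OF assms]
  have "word_val G [s, t, s, t] = word_val G []"
    by (intro coxeter_cong_word_val) (simp add: numeral_2_eq_2)
  hence "(s \<otimes> t) \<otimes> (s \<otimes> t) = \<one>"
    using assms by (simp add: m_assoc)
  hence "inv (s \<otimes> t) = s \<otimes> t"
    using assms by (intro inv_equality) auto
  thus ?thesis using assms by (simp add: inv_mult_group)
qed

text \<open>Right-angledness and the matrix axioms leave only the relators \<open>s s\<close> and
  \<open>s t s t\<close>; invariants of \<open>coxeter_cong\<close> are checked on these
  two.\<close>

lemma relation_cases:
  assumes "s \<in> S" "t \<in> S" "m s t = enat k"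
  obtains "k = 1" "s = t" | "k = 2" "s \<noteq> t" "s \<otimes> t = t \<otimes> s"
proof -
  have *: "m s t \<in> {1, 2, \<infinity>}" "s \<noteq> t \<Longrightarrow> 2 \<le> m s t" "s = t \<Longrightarrow> m s t = 1"
    using right_angled matrix assms(1,2) by (simp_all add: right_angled_def coxeter_matrix_def)
  hence "enat k = enat 1 \<or> enat k = enat 2"
    using assms(3) by (simp add: one_enat_def numeral_eq_enat)
  thus ?thesis
  proof
    assume k: "enat k = enat 1"
    hence "\<not> 2 \<le> m s t" using assms(3) by (simp add: numeral_eq_enat)
    thus ?thesis using that(1) *(2) k by auto
  next
    assume k: "enat k = enat 2"
    hence "s \<noteq> t" using *(3) assms(3) by (auto simp: one_enat_def)
    thus ?thesis using that(2) gen_commute[OF assms(1,2)] k assms(3) by simp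
  qed
qed

lemma word_exists:
  assumes "x \<in> carrier G" shows "\<exists>w\<in>lists S. word_val G w = x"
proof -
  have "x \<in> generate G S" using assms generators_generate by simp
  thus ?thesis
  proof (induction rule: generate.induct)
    case one
    show ?case by (rule bexI[of _ "[]"]) auto
  next
    case (incl h)
    thus ?case by (intro bexI[of _ "[h]"]) auto
  next
    case (inv h)
    thus ?case by (intro bexI[of _ "[h]"]) auto
  next
    case (eng h1 h2)
    then obtain v w where "v \<in> lists S" "word_val G v = h1" "w \<in> lists S" "word_val G w = h2"
      by blast
    thus ?case by (intro bexI[of _ "v @ w"]) (auto simp: word_val_append)
  qed
qed

lemma cox_length_le: "w \<in> lists S \<Longrightarrow> cox_length G S (word_val G w) \<le> length w"
  unfolding cox_length_def by (rule Least_le) blast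

lemma reduced_word:
  assumes "x \<in> carrier G"
  obtains w where "w \<in> lists S" "word_val G w = x" "length w = cox_length G S x"
proof -
  have "\<exists>n. \<exists>w\<in>lists S. length w = n \<and> word_val G w = x"
    using word_exists[OF assms] by blast
  from LeastI_ex[OF this] show ?thesis
    using that unfolding cox_length_def by blast
qed

lemma cox_length_mult_le:
  assumes "x \<in> carrier G" "y \<in> carrier G"
  shows "cox_length G S (x \<otimes> y) \<le> cox_length G S x + cox_length G S y"
proof -
  obtain v w where "v \<in> lists S" "word_val G v = x" "length v = cox_length G S x"
    "w \<in> lists S" "word_val G w = y" "length w = cox_length G S y"
    using assms by (metis reduced_word)
  thus ?thesis using cox_length_le[of "v @ w"] by (simp add: word_val_append)
qed

section \<open>Conjugation of reflections and inversion sets\<close>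

text \<open>The reflection \<open>t\<close> as seen from \<open>x\<close>: left translation by
  \<open>inv x\<close> moves the wall of \<open>t\<close> to the wall of
  \<open>conj_inv x t\<close>.\<close>

definition conj_inv :: "'a \<Rightarrow> 'a \<Rightarrow> 'a" where
  "conj_inv x t = inv x \<otimes> t \<otimes> x"

lemma conj_inv_closed [simp, intro]:
  "x \<in> carrier G \<Longrightarrow> t \<in> carrier G \<Longrightarrow> conj_inv x t \<in> carrier G"
  by (simp add: conj_inv_def)

lemma conj_inv_one [simp]: "t \<in> carrier G \<Longrightarrow> conj_inv \<one> t = t"
  by (simp add: conj_inv_def)

lemma conj_inv_mult:
  "x \<in> carrier G \<Longrightarrow> y \<in> carrier G \<Longrightarrow> t \<in> carrier G
    \<Longrightarrow> conj_inv (x \<otimes> y) t = conj_inv y (conj_inv x t)"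
  by (simp add: conj_inv_def inv_mult_group m_assoc)

lemma conj_inv_inv [simp]:
  "x \<in> carrier G \<Longrightarrow> t \<in> carrier G \<Longrightarrow> conj_inv x (conj_inv (inv x) t) = t"
  "x \<in> carrier G \<Longrightarrow> t \<in> carrier G \<Longrightarrow> conj_inv (inv x) (conj_inv x t) = t"
  by (simp_all flip: conj_inv_mult)

lemma conj_inv_commute:
  "x \<in> carrier G \<Longrightarrow> t \<in> carrier G \<Longrightarrow> conj_inv x t = t \<longleftrightarrow> x \<otimes> t = t \<otimes> x"
  by (metis conj_inv_def inv_closed inv_solve_left m_assoc m_closed)

lemma conj_inv_gen_self [simp]: "s \<in> S \<Longrightarrow> conj_inv s s = s"
  by (simp add: conj_inv_commute)

lemma mult_conj_inv:
  "x \<in> carrier G \<Longrightarrow> t \<in> carrier G \<Longrightarrow> x \<otimes> conj_inv x t = t \<otimes> x"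
  by (simp add: conj_inv_def flip: m_assoc)

lemma conj_inv_eq_iff:
  "x \<in> carrier G \<Longrightarrow> s \<in> carrier G \<Longrightarrow> t \<in> carrier G
    \<Longrightarrow> conj_inv x t = s \<longleftrightarrow> t = conj_inv (inv x) s"
  by (metis conj_inv_inv)

lemma inj_on_conj_inv: "x \<in> carrier G \<Longrightarrow> A \<subseteq> carrier G \<Longrightarrow> inj_on (conj_inv x) A"
  by (rule inj_on_inverseI[of _ "conj_inv (inv x)"]) auto

text \<open>
  The elements that occur an odd number of times among the reflections
  \<open>s\<^sub>1 \<dots> s\<^sub>i \<dots> s\<^sub>1\<close> attached to a word \<open>s\<^sub>1 \<dots> s\<^sub>n\<close>; the parity makes this
  invariant under the Coxeter relations.
\<close>

fun word_inversions :: "'a list \<Rightarrow> 'a set" where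
  "word_inversions [] = {}"
| "word_inversions (s # w) = {t \<in> carrier G. (t = s) \<noteq> (conj_inv s t \<in> word_inversions w)}"

lemma word_inversions_carrier: "word_inversions w \<subseteq> carrier G"
  by (cases w) auto

lemma word_inversions_append:
  assumes "v \<in> lists S" "w \<in> lists S" "t \<in> carrier G"
  shows "t \<in> word_inversions (v @ w) \<longleftrightarrow>
    (t \<in> word_inversions v) \<noteq> (conj_inv (word_val G v) t \<in> word_inversions w)"
  using assms by (induction v arbitrary: t) (auto simp: conj_inv_mult)

text \<open>The relator \<open>s s\<close> crosses the wall of \<open>s\<close> twice, and
  \<open>s t s t\<close> with commuting letters crosses each of its two walls twice, so relators
  contribute nothing modulo 2.\<close>

lemma word_inversions_cong:
  "coxeter_cong S m v w \<Longrightarrow> word_inversions v = word_inversions w"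
proof (induction rule: coxeter_cong.induct)
  case (relation s t k)
  from relation show ?case
  proof (cases rule: relation_cases)
    case 1
    have "conj_inv s x = s \<longleftrightarrow> x = s" if "x \<in> carrier G" for x
      using relation that conj_inv_commute[of s s] by (simp add: conj_inv_eq_iff)
    thus ?thesis using 1 relation by auto
  next
    case 2
    have fixed: "conj_inv s s = s" "conj_inv s t = t" "conj_inv t s = s" "conj_inv t t = t"
      using 2 relation by (simp_all add: conj_inv_commute)
    have "conj_inv s x = t \<longleftrightarrow> x = t" "conj_inv t x = s \<longleftrightarrow> x = s"
      "conj_inv s x = s \<longleftrightarrow> x = s" "conj_inv t x = t \<longleftrightarrow> x = t" if "x \<in> carrier G" for x
      using relation that by (simp_all add: conj_inv_eq_iff fixed)
    thus ?thesis using 2 relation by (auto simp: numeral_2_eq_2)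
  qed
next
  case (append v w v' w')
  from append.hyps have l: "v \<in> lists S" "w \<in> lists S" "v' \<in> lists S" "w' \<in> lists S"
    using coxeter_cong_lists by blast+
  have "word_val G v = word_val G w"
    using append.hyps coxeter_cong_word_val by blast
  hence "t \<in> word_inversions (v @ v') \<longleftrightarrow> t \<in> word_inversions (w @ w')" if "t \<in> carrier G" for t
    using l that append.IH by (simp add: word_inversions_append)
  thus ?case
    using word_inversions_carrier by blast
qed simp_all

text \<open>The chosen word is immaterial: two words for \<open>x\<close> are congruent, hence have
  the same odd crossings.\<close>

definition inversions :: "'a \<Rightarrow> 'a set" where
  "inversions x = word_inversions (SOME w. w \<in> lists S \<and> word_val G w = x)"

lemma inversions_word_val:
  assumes "w \<in> lists S" shows "inversions (word_val G w) = word_inversions w"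
proof -
  define v where "v = (SOME v. v \<in> lists S \<and> word_val G v = word_val G w)"
  have "v \<in> lists S \<and> word_val G v = word_val G w"
    unfolding v_def by (rule someI[of _ w]) (simp add: assms)
  hence "coxeter_cong S m v w"
    using presentation assms by blast
  thus ?thesis
    unfolding inversions_def v_def[symmetric] by (rule word_inversions_cong)
qed

lemma inversions_carrier: "inversions x \<subseteq> carrier G"
  unfolding inversions_def by (rule word_inversions_carrier)

lemma inversions_one [simp]: "inversions \<one> = {}"
  using inversions_word_val[of "[]"] by simp

lemma inversions_gen [simp]: "s \<in> S \<Longrightarrow> inversions s = {s}"
  using inversions_word_val[of "[s]"] by auto

text \<open>The cocycle identity: modulo 2, N(x y) is the sum of N(x) and the conjugate x N(y)
  x^-1.\<close>

lemma in_inversions_mult: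
  assumes "x \<in> carrier G" "y \<in> carrier G" "t \<in> carrier G"
  shows "t \<in> inversions (x \<otimes> y) \<longleftrightarrow> (t \<in> inversions x) \<noteq> (conj_inv x t \<in> inversions y)"
proof -
  obtain v w where "v \<in> lists S" "word_val G v = x" "w \<in> lists S" "word_val G w = y"
    using word_exists assms by meson
  thus ?thesis
    using word_inversions_append[of v w t] inversions_word_val[of v] inversions_word_val[of w]
      inversions_word_val[of "v @ w"] assms by (simp add: word_val_append)
qed

text \<open>Translates the walls separating \<open>x\<close> from \<open>y\<close> so that
  \<open>x\<close> becomes the identity; there they are plain inversions.\<close>

lemma in_inversions_inv_mult:
  assumes "x \<in> carrier G" "y \<in> carrier G" "t \<in> carrier G"
  shows "conj_inv x t \<in> inversions (inv x \<otimes> y) \<longleftrightarrow> (t \<in> inversions x) \<noteq> (t \<in> inversions y)"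
  using in_inversions_mult[of x "inv x \<otimes> y" t] assms by (auto simp flip: m_assoc)

text \<open>An edge of the Cayley graph crosses a single wall, that of the reflection x s
  x^-1.\<close>

lemma inversions_mult_gen:
  assumes "x \<in> carrier G" "s \<in> S"
  shows "inversions (x \<otimes> s) = sym_diff (inversions x) {conj_inv (inv x) s}"
proof -
  have "t \<in> inversions (x \<otimes> s) \<longleftrightarrow> t \<in> sym_diff (inversions x) {conj_inv (inv x) s}"
    if "t \<in> carrier G" for t
    using assms that in_inversions_mult[of x s t] conj_inv_eq_iff[of x s t] by auto
  moreover have "conj_inv (inv x) s \<in> carrier G"
    using assms by auto
  ultimately show ?thesis
    using inversions_carrier by blast
qed

section \<open>Exchange, and length as the number of inversions\<close>

text \<open>Strong exchange: a reflection with odd count is attached to some letter, and deleting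
  that letter multiplies the value by \<open>t\<close> on the left.\<close>

lemma word_inversions_delete:
  assumes "w \<in> lists S" "t \<in> word_inversions w"
  shows "\<exists>w'\<in>lists S. length w' < length w \<and> word_val G w' = t \<otimes> word_val G w"
  using assms
proof (induction w arbitrary: t)
  case (Cons s w)
  hence t: "t \<in> carrier G" and s: "s \<in> S" and w: "w \<in> lists S" by auto
  show ?case
  proof (cases "t = s")
    case True
    thus ?thesis using s w by (intro bexI[of _ w]) auto
  next
    case False
    then obtain w' where w': "w' \<in> lists S" "length w' < length w"
      "word_val G w' = conj_inv s t \<otimes> word_val G w"
      using Cons.IH[of "conj_inv s t"] Cons.prems by auto
    have "word_val G (s # w') = (s \<otimes> conj_inv s t) \<otimes> word_val G w"
      using w' s t w by (simp add: m_assoc conj_inv_closed)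
    also have "\<dots> = t \<otimes> word_val G (s # w)"
      using s t w by (simp add: mult_conj_inv m_assoc)
    finally show ?thesis
      using w' s by (intro bexI[of _ "s # w'"]) auto
  qed
qed auto

lemma cox_length_inversion:
  assumes "x \<in> carrier G" "t \<in> inversions x"
  shows "cox_length G S (t \<otimes> x) < cox_length G S x"
proof -
  obtain w where w: "w \<in> lists S" "word_val G w = x" "length w = cox_length G S x"
    using assms reduced_word by blast
  with assms inversions_word_val[of w] word_inversions_delete[of w t]
  obtain w' where "w' \<in> lists S" "length w' < length w" "word_val G w' = t \<otimes> x" by auto
  thus ?thesis using cox_length_le[of w'] w by auto
qed

text \<open>A reduced word crosses no wall twice: if its first letter were an inversion of the tail,
  exchange would make the whole product shorter than the tail.\<close>

lemma card_word_inversions: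
  assumes "w \<in> lists S" "cox_length G S (word_val G w) = length w"
  shows "finite (word_inversions w) \<and> card (word_inversions w) = length w"
  using assms
proof (induction w)
  case (Cons s w)
  hence s: "s \<in> S" and w: "w \<in> lists S" by auto
  have "cox_length G S s \<le> 1" using cox_length_le[of "[s]"] s by simp
  hence "cox_length G S (s \<otimes> word_val G w) \<le> 1 + cox_length G S (word_val G w)"
    using cox_length_mult_le[of s "word_val G w"] s w by fastforce
  hence len: "cox_length G S (word_val G w) = length w"
    using Cons.prems cox_length_le[OF w] by simp
  note IH = Cons.IH[OF len]
  let ?I = "conj_inv s ` word_inversions w"
  have "conj_inv s (conj_inv s t) = t" if "t \<in> carrier G" for t
    using conj_inv_inv[of s t] s that by simp
  hence image: "conj_inv s t \<in> word_inversions w \<longleftrightarrow> t \<in> ?I" if "t \<in> carrier G" for t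
    using that word_inversions_carrier by (metis (no_types, lifting) image_iff subsetD)
  have "s \<notin> word_inversions w"
    using cox_length_inversion[of "word_val G w" s] Cons.prems len w
    by (auto simp: inversions_word_val)
  hence "s \<notin> ?I" using image[of s] s by simp
  moreover have "word_inversions (s # w) = insert s ?I"
  proof (rule Set.set_eqI)
    fix t
    have "?I \<subseteq> carrier G" using s word_inversions_carrier by auto
    hence "t \<in> ?I \<Longrightarrow> t \<in> carrier G" by blast
    thus "t \<in> word_inversions (s # w) \<longleftrightarrow> t \<in> insert s ?I"
      using image[of t] \<open>s \<notin> ?I\<close> gen_closed[OF s]
      unfolding word_inversions.simps mem_Collect_eq insert_iff by metis
  qed
  moreover have "inj_on (conj_inv s) (word_inversions w)"
    using s word_inversions_carrier by (intro inj_on_conj_inv) auto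
  ultimately show ?case using IH by (simp add: card_image)
qed auto

lemma finite_inversions [simp]: "x \<in> carrier G \<Longrightarrow> finite (inversions x)"
  and card_inversions: "x \<in> carrier G \<Longrightarrow> card (inversions x) = cox_length G S x"
  by (metis reduced_word card_word_inversions inversions_word_val)+

section \<open>Descents, separating walls and the weak order\<close>

lemma descent_exists:
  assumes "x \<in> carrier G" "x \<noteq> \<one>" shows "\<exists>s\<in>S. s \<in> inversions x"
proof -
  obtain w where w: "w \<in> lists S" "word_val G w = x" "length w = cox_length G S x"
    using assms reduced_word by blast
  then obtain s v where sv: "w = s # v" "s \<in> S" "v \<in> lists S"
    using assms by (cases w) auto
  have v: "s \<otimes> x = word_val G v" using sv w(2) by (metis gen_cancel word_val_Cons word_val_closed)
  hence "cox_length G S (s \<otimes> x) < cox_length G S x"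
    using cox_length_le[of v] sv w by simp
  hence "s \<notin> inversions (s \<otimes> x)"
    using cox_length_inversion[of "s \<otimes> x" s] sv assms by auto
  hence "s \<in> inversions x"
    using in_inversions_mult[of s x s] sv assms conj_inv_commute[of s s] by auto
  thus ?thesis using sv by blast
qed

text \<open>A left descent of \<open>inv x \<otimes> y\<close> labels an edge at \<open>x\<close>
  whose wall separates \<open>x\<close> from \<open>y\<close>.\<close>

lemma step_towards:
  assumes "x \<in> carrier G" "y \<in> carrier G" "x \<noteq> y"
  obtains s where "s \<in> S" "conj_inv (inv x) s \<in> sym_diff (inversions x) (inversions y)"
proof -
  have "inv x \<otimes> y \<noteq> \<one>" using assms by (metis inv_equality inv_inv inv_closed)
  then obtain s where s: "s \<in> S" "s \<in> inversions (inv x \<otimes> y)"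
    using descent_exists[of "inv x \<otimes> y"] assms by auto
  have "conj_inv (inv x) s \<in> sym_diff (inversions x) (inversions y)"
    using in_inversions_inv_mult[of x y "conj_inv (inv x) s"] assms s by auto
  with s that show ?thesis by blast
qed

lemma inversions_inject:
  assumes "x \<in> carrier G" "y \<in> carrier G" "inversions x = inversions y" shows "x = y"
  using assms step_towards[of x y] by blast

text \<open>An edge toggles one wall, and length counts inversions, so a cover can only add its
  wall.\<close>

lemma weak_order_inversions_mono:
  assumes "(right_weak_cover G S)\<^sup>*\<^sup>* x y" "x \<in> carrier G"
  shows "y \<in> carrier G \<and> inversions x \<subseteq> inversions y"
  using assms
proof (induction rule: rtranclp_induct)
  case (step y z)
  then obtain s where s: "s \<in> S" "z = y \<otimes> s" "cox_length G S z = cox_length G S y + 1"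
    and y: "y \<in> carrier G" and sub: "inversions x \<subseteq> inversions y"
    by (auto simp: right_weak_cover_def)
  have z: "z \<in> carrier G" using s y by auto
  have eq: "inversions z = sym_diff (inversions y) {conj_inv (inv y) s}"
    using inversions_mult_gen s y by simp
  have "conj_inv (inv y) s \<notin> inversions y"
  proof
    assume "conj_inv (inv y) s \<in> inversions y"
    hence "inversions z \<subseteq> inversions y" using eq by auto
    hence "card (inversions z) \<le> card (inversions y)" using y by (intro card_mono) auto
    thus False using s z y by (simp add: card_inversions)
  qed
  thus ?case using eq z sub by auto
qed auto

text \<open>Walk from \<open>x\<close> towards \<open>y\<close>: by inclusion every separating wall
  is an inversion of \<open>y\<close> only, so each step is a cover and stays below
  \<open>y\<close>.\<close>

lemma inversions_mono_weak_order:
  assumes "x \<in> carrier G" "y \<in> carrier G" "inversions x \<subseteq> inversions y"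
  shows "(right_weak_cover G S)\<^sup>*\<^sup>* x y"
  using assms
proof (induction "card (inversions y - inversions x)" arbitrary: x rule: less_induct)
  case less
  show ?case
  proof (cases "x = y")
    case False
    then obtain s where s: "s \<in> S"
      and c: "conj_inv (inv x) s \<in> inversions y" "conj_inv (inv x) s \<notin> inversions x"
      using step_towards[of x y] less.prems by blast
    have xs: "x \<otimes> s \<in> carrier G" using s less.prems by auto
    have eq: "inversions (x \<otimes> s) = insert (conj_inv (inv x) s) (inversions x)"
      using inversions_mult_gen[of x s] s c less.prems by auto
    have "card (inversions (x \<otimes> s)) = card (inversions x) + 1"
      using c less.prems by (simp add: eq)
    hence "right_weak_cover G S x (x \<otimes> s)"
      using s xs less.prems by (auto simp: right_weak_cover_def card_inversions)
    moreover have "(right_weak_cover G S)\<^sup>*\<^sup>* (x \<otimes> s) y"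
      using c less.prems xs by (intro less.hyps psubset_card_mono) (auto simp: eq)
    ultimately show ?thesis by (rule converse_rtranclp_into_rtranclp)
  qed auto
qed

section \<open>Commutation of left descents\<close>

text \<open>Each letter acts as an involution, and since \<open>m a b = \<infinity>\<close> at most
  one letter of a commutation relator acts nontrivially.\<close>

lemma dihedral_act_cong:
  assumes "coxeter_cong S m v w" "a \<in> S" "b \<in> S" "a \<noteq> b" "m a b = \<infinity>"
  shows "dihedral_act a b v = dihedral_act a b w"
  using assms(1)
proof (induction rule: coxeter_cong.induct)
  case (relation s t k)
  have "m b a = \<infinity>" using matrix assms by (auto simp: coxeter_matrix_def)
  from relation show ?case
  proof (cases rule: relation_cases)
    case 1
    thus ?thesis by auto
  next
    case 2
    hence "\<not> (s = a \<and> t = b)" "\<not> (s = b \<and> t = a)"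
      using relation assms \<open>m b a = \<infinity>\<close> by auto
    thus ?thesis using 2 by (auto simp: numeral_2_eq_2)
  qed
next
  case (append v w v' w')
  thus ?case by (auto simp: dihedral_act_append)
qed simp_all

lemma cox_length_alternating:
  assumes "a \<in> S" "b \<in> S" "a \<noteq> b" "m a b = \<infinity>"
  shows "cox_length G S (word_val G (alternating a b k)) = k"
proof (rule antisym)
  have alt: "alternating a b k \<in> lists S"
    using assms set_alternating[of a b k] by auto
  show "cox_length G S (word_val G (alternating a b k)) \<le> k"
    using cox_length_le[OF alt] by simp
  obtain w where w: "w \<in> lists S" "word_val G w = word_val G (alternating a b k)"
    "length w = cox_length G S (word_val G (alternating a b k))"
    using reduced_word alt by (metis word_val_closed)
  hence "dihedral_act a b w = dihedral_act a b (alternating a b k)"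
    using dihedral_act_cong[of w "alternating a b k" a b] presentation[of w] alt assms by simp
  hence "dihedral_act a b w 0 = - int k"
    using assms by (simp add: dihedral_act_alternating)
  thus "k \<le> cox_length G S (word_val G (alternating a b k))"
    using dihedral_act_abs_le[of a b w 0] w by simp
qed

text \<open>
  If \<open>a\<close> and \<open>b\<close> generate an infinite dihedral group and are both left descents of \<open>x\<close>, then by
  exchange \<open>x\<close> has reduced words starting with arbitrarily long alternating words.
\<close>

lemma alternating_prefix:
  assumes "a \<in> S" "b \<in> S" "a \<noteq> b" "m a b = \<infinity>"
    and "x \<in> carrier G" "a \<in> inversions x" "b \<in> inversions x"
  shows "\<exists>y\<in>carrier G. x = word_val G (alternating a b k) \<otimes> y \<and>
    k + cox_length G S y \<le> cox_length G S x"
  using assms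
proof (induction k arbitrary: a b)
  case 0
  thus ?case by (intro bexI[of _ x]) auto
next
  case (Suc k)
  have "m b a = \<infinity>" using Suc.prems matrix by (auto simp: coxeter_matrix_def)
  define p where "p = word_val G (alternating b a k)"
  have "alternating b a k \<in> lists S"
    using Suc.prems set_alternating[of b a k] by auto
  hence p: "p \<in> carrier G" by (auto simp: p_def)
  obtain y where y: "y \<in> carrier G" "x = p \<otimes> y" "k + cox_length G S y \<le> cox_length G S x"
    using Suc.IH[of b a] Suc.prems \<open>m b a = \<infinity>\<close> unfolding p_def by auto
  \<comment> \<open>Prefixing \<open>a\<close> to \<open>p\<close> gives a longer alternating word,
    so \<open>a\<close> is not an inversion of \<open>p\<close>. Its wall is therefore crossed
    within \<open>y\<close>, and exchange shortens \<open>y\<close> to \<open>z\<close>.\<close>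
  have "cox_length G S (a \<otimes> p) = Suc k" "cox_length G S p = k"
    using cox_length_alternating[of a b "Suc k"] cox_length_alternating[of b a k] Suc.prems
      \<open>m b a = \<infinity>\<close> by (simp_all add: p_def)
  hence "a \<notin> inversions p"
    using cox_length_inversion[of p a] p by auto
  hence inv: "conj_inv p a \<in> inversions y"
    using in_inversions_mult[of p y a] Suc.prems p y by auto
  define z where "z = conj_inv p a \<otimes> y"
  have ca: "conj_inv p a \<in> carrier G" using p Suc.prems by auto
  have "cox_length G S z < cox_length G S y"
    unfolding z_def using cox_length_inversion inv y by blast
  moreover have "x = a \<otimes> p \<otimes> z"
  proof -
    have "p \<otimes> z = (p \<otimes> conj_inv p a) \<otimes> y" using p y ca by (simp add: z_def m_assoc)
    also have "\<dots> = a \<otimes> x" using p y Suc.prems by (simp add: mult_conj_inv m_assoc)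
    finally have "a \<otimes> (p \<otimes> z) = x" using Suc.prems by simp
    thus ?thesis using p ca y Suc.prems by (simp add: m_assoc z_def)
  qed
  ultimately show ?case
    using y ca by (intro bexI[of _ z]) (auto simp: z_def p_def)
qed

text \<open>For \<open>m a b = \<infinity>\<close> there would be an alternating prefix longer than
  \<open>x\<close> itself. So \<open>m a b\<close> is finite, and the relation is a
  commutation.\<close>

lemma descents_commute:
  assumes "a \<in> S" "b \<in> S" "x \<in> carrier G" "a \<in> inversions x" "b \<in> inversions x"
  shows "a \<otimes> b = b \<otimes> a"
proof (cases "a = b")
  case False
  have "m a b \<noteq> \<infinity>"
    using alternating_prefix[of a b x "Suc (cox_length G S x)"] False assms by auto
  then obtain k where "m a b = enat k" by auto
  from assms(1,2) this show ?thesis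
    by (cases rule: relation_cases) auto
qed auto

section \<open>Crossing walls are perpendicular\<close>

lemma in_inversions_descent_mult:
  assumes "a \<in> S" "x \<in> carrier G" "a \<in> inversions x" "t \<in> carrier G"
  shows "t \<in> inversions (a \<otimes> x) \<longleftrightarrow> t \<noteq> a \<and> conj_inv a t \<in> inversions x"
  using assms in_inversions_mult[of a x t] conj_inv_commute[of a a] by auto

text \<open>The edge from \<open>y\<close> to \<open>y \<otimes> s = r \<otimes> y\<close> crosses
  the wall of \<open>r\<close>. Hence any left descent \<open>a\<close> of \<open>y\<close> is, like
  \<open>r\<close>, a left descent of \<open>r \<otimes> y\<close>, so \<open>a\<close> and
  \<open>r\<close> commute. Stripping \<open>a\<close> preserves the hypotheses, and induction
  treats \<open>t\<close> conjugated by \<open>a\<close>.\<close>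

lemma inversions_commute_gen:
  assumes "r \<in> S" "s \<in> S" "y \<in> carrier G" "conj_inv y r = s" "r \<notin> inversions y"
    and "t \<in> inversions y"
  shows "r \<otimes> t = t \<otimes> r"
  using assms
proof (induction "cox_length G S y" arbitrary: y t rule: less_induct)
  case less
  note y = \<open>y \<in> carrier G\<close> and r = \<open>r \<in> S\<close>
  have "y \<noteq> \<one>" using less.prems by auto
  then obtain a where a: "a \<in> S" "a \<in> inversions y" using descent_exists y by blast
  have ys: "y \<otimes> s = r \<otimes> y" using less.prems mult_conj_inv[of y r] by auto
  have "conj_inv (inv y) s = r" using less.prems by auto
  hence eq: "inversions (r \<otimes> y) = insert r (inversions y)"
    using inversions_mult_gen[of y s] less.prems ys by auto
  have ar: "a \<otimes> r = r \<otimes> a"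
    using a r y eq descents_commute[of a r "r \<otimes> y"] by auto
  hence car: "conj_inv a r = r" using a r by (simp add: conj_inv_commute)
  show ?case
  proof (cases "t = a")
    case False
    have t: "t \<in> carrier G" using less.prems inversions_carrier by blast
    define u where "u = conj_inv a t"
    have u: "u \<in> carrier G" "conj_inv a u = t"
      using t a conj_inv_inv[of a t] by (auto simp: u_def)
    have "u \<noteq> a" using False u a conj_inv_commute[of a a] by auto
    hence "u \<in> inversions (a \<otimes> y)"
      using in_inversions_descent_mult[of a y u] a y u less.prems by auto
    moreover have "r \<notin> inversions (a \<otimes> y)"
      using in_inversions_descent_mult[of a y r] a y r car less.prems by auto
    moreover have "conj_inv (a \<otimes> y) r = s"
      using a y r car less.prems by (simp add: conj_inv_mult)
    ultimately have ru: "r \<otimes> u = u \<otimes> r"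
      using less.hyps[of "a \<otimes> y" u] cox_length_inversion[OF y a(2)] a y less.prems by auto
    hence "conj_inv r u = u" using r u by (simp add: conj_inv_commute)
    have "conj_inv r t = conj_inv (a \<otimes> r) u" using a r u by (simp add: conj_inv_mult)
    also have "\<dots> = conj_inv (r \<otimes> a) u" using ar by simp
    also have "\<dots> = t" using a r u \<open>conj_inv r u = u\<close> by (simp add: conj_inv_mult)
    finally show ?thesis using r t by (simp add: conj_inv_commute)
  qed (use ar in auto)
qed

text \<open>
  If all four quadrants cut out by the walls of \<open>r\<close> and \<open>t\<close> contain chambers, then the walls
  cross at right angles. Moving from \<open>x\<close> towards \<open>y\<close>, the wall of \<open>r\<close> is crossed at an element
  that conjugates \<open>r\<close> to a simple generator.
\<close>

lemma crossing_commute: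
  assumes "r \<in> S" "x \<in> carrier G" "y \<in> carrier G"
    and "t \<in> inversions x" "t \<in> inversions y" "r \<notin> inversions x" "r \<in> inversions y"
  shows "r \<otimes> t = t \<otimes> r"
  using assms
proof (induction "card (sym_diff (inversions x) (inversions y))" arbitrary: x rule: less_induct)
  case less
  obtain s where s: "s \<in> S"
    and c: "conj_inv (inv x) s \<in> sym_diff (inversions x) (inversions y)"
    using step_towards[of x y] less.prems by blast
  have eq: "inversions (x \<otimes> s) = sym_diff (inversions x) {conj_inv (inv x) s}"
    using inversions_mult_gen s less.prems by blast
  show ?case
  proof (cases "conj_inv (inv x) s = r")
    case True
    hence "conj_inv x r = s" using s less.prems by auto
    thus ?thesis using inversions_commute_gen[of r s x t] s less.prems by blast
  next
    case False
    have "card (sym_diff (inversions (x \<otimes> s)) (inversions y)) <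
      card (sym_diff (inversions x) (inversions y))"
      using c less.prems by (intro psubset_card_mono) (auto simp: eq)
    \<comment> \<open>Only a wall separating \<open>x\<close> from \<open>y\<close> is crossed; that
      of \<open>t\<close> does not separate them, so \<open>t\<close> remains an inversion.\<close>
    moreover have "x \<otimes> s \<in> carrier G" "t \<in> inversions (x \<otimes> s)" "r \<notin> inversions (x \<otimes> s)"
      using s c False less.prems by (auto simp: eq)
    ultimately show ?thesis using less.hyps[of "x \<otimes> s"] less.prems by blast
  qed
qed

section \<open>Common descents and meets of inversion sets\<close>

lemma common_descent:
  assumes "x \<in> carrier G" "y \<in> carrier G" "t \<in> inversions x" "t \<in> inversions y"
  obtains r where "r \<in> S" "r \<in> inversions x" "r \<in> inversions y"
proof -
  define z where "z = arg_min (cox_length G S) (\<lambda>z. z \<in> carrier G \<and> t \<in> inversions z)"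
  have z: "z \<in> carrier G" "t \<in> inversions z"
    using arg_min_natI[of "\<lambda>z. z \<in> carrier G \<and> t \<in> inversions z" x] assms
    by (auto simp: z_def)
  have min: "cox_length G S z \<le> cox_length G S w" if "w \<in> carrier G" "t \<in> inversions w" for w
    using arg_min_nat_le[of "\<lambda>z. z \<in> carrier G \<and> t \<in> inversions z" w] that
    by (auto simp: z_def)
  have t: "t \<in> carrier G" using assms inversions_carrier by blast
  have "z \<noteq> \<one>" using z by auto
  then obtain r where r: "r \<in> S" "r \<in> inversions z"
    using descent_exists z by blast
  have "r \<in> inversions w" if w: "w \<in> carrier G" "t \<in> inversions w" for w
  proof (rule ccontr)
    assume nr: "r \<notin> inversions w"
    hence "r \<noteq> t" using w by auto
    \<comment> \<open>Both \<open>w\<close> and \<open>z\<close> have inversion \<open>t\<close>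
      while \<open>r\<close> separates them, so the walls cross. Thus \<open>t\<close> survives in
      the shorter \<open>r \<otimes> z\<close>, against minimality.\<close>
    have "conj_inv r t = t"
      using crossing_commute[of r w z t] r w z nr t by (simp add: conj_inv_commute)
    hence "t \<in> inversions (r \<otimes> z)"
      using in_inversions_descent_mult[of r z t] r z t \<open>r \<noteq> t\<close> by auto
    hence "cox_length G S z \<le> cox_length G S (r \<otimes> z)"
      using min r z by auto
    thus False using cox_length_inversion[of z r] r z by auto
  qed
  with that r assms show ?thesis by blast
qed

text \<open>Take \<open>z\<close> with the most inversions among the common lower bounds. If a
  common inversion were missing from \<open>z\<close>, then seen from \<open>z\<close> the elements
  \<open>x\<close> and \<open>y\<close> would share an inversion, hence a left descent
  \<open>r\<close>, and \<open>z \<otimes> r\<close> would be a larger lower bound.\<close>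

lemma inversions_meet:
  assumes "x \<in> carrier G" "y \<in> carrier G"
  obtains z where "z \<in> carrier G" "inversions z = inversions x \<inter> inversions y"
proof -
  define P where "P z \<longleftrightarrow> z \<in> carrier G \<and> inversions z \<subseteq> inversions x \<inter> inversions y" for z
  have "P \<one>" by (auto simp: P_def)
  moreover have "\<forall>z. P z \<longrightarrow> card (inversions z) < Suc (card (inversions x))"
    using assms by (auto simp: P_def less_Suc_eq_le intro!: card_mono)
  ultimately obtain z where z: "P z" "\<And>w. P w \<Longrightarrow> card (inversions w) \<le> card (inversions z)"
    using ex_has_greatest_nat[of P \<one> "\<lambda>z. card (inversions z)"] by blast
  have zc: "z \<in> carrier G" using z by (auto simp: P_def)
  have "inversions x \<inter> inversions y \<subseteq> inversions z"
  proof
    fix t assume t: "t \<in> inversions x \<inter> inversions y"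
    hence tc: "t \<in> carrier G" using inversions_carrier by blast
    show "t \<in> inversions z"
    proof (rule ccontr)
      assume nt: "t \<notin> inversions z"
      have "conj_inv z t \<in> inversions (inv z \<otimes> x)" "conj_inv z t \<in> inversions (inv z \<otimes> y)"
        using in_inversions_inv_mult[of z _ t] zc tc t nt assms by auto
      then obtain r where r: "r \<in> S" "r \<in> inversions (inv z \<otimes> x)" "r \<in> inversions (inv z \<otimes> y)"
        using common_descent[of "inv z \<otimes> x" "inv z \<otimes> y" "conj_inv z t"] zc assms by auto
      define c where "c = conj_inv (inv z) r"
      have c: "c \<in> carrier G" "conj_inv z c = r" using r zc by (auto simp: c_def)
      \<comment> \<open>The wall of \<open>c\<close> separates \<open>z\<close> from
        \<open>x\<close> and from \<open>y\<close>; as \<open>z\<close> lies below both,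
        \<open>c\<close> can be missing only from \<open>z\<close>.\<close>
      have "c \<in> inversions x - inversions z" "c \<in> inversions y - inversions z"
        using in_inversions_inv_mult[of z x c] in_inversions_inv_mult[of z y c] z r c zc assms
        by (auto simp: P_def)
      moreover from this have eq: "inversions (z \<otimes> r) = insert c (inversions z)"
        using inversions_mult_gen[of z r] zc r by (auto simp: c_def)
      ultimately have "P (z \<otimes> r)" using z r by (auto simp: P_def)
      from z(2)[OF this] show False
        using eq \<open>c \<in> inversions x - inversions z\<close> zc by simp
    qed
  qed
  thus ?thesis using that[of z] z(1) by (simp add: P_def subset_antisym)
qed

section \<open>Distance and convexity in the Cayley graph\<close>

lemma cayley_adj_pow:
  assumes "x \<in> carrier G"
  shows "(cayley_adj G S ^^ n) x y \<longleftrightarrow> (\<exists>w\<in>lists S. length w = n \<and> y = x \<otimes> word_val G w)"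
  using assms
proof (induction n arbitrary: x)
  case (Suc n)
  have "(cayley_adj G S ^^ Suc n) x y \<longleftrightarrow> (\<exists>s\<in>S. (cayley_adj G S ^^ n) (x \<otimes> s) y)"
    using Suc.prems by (auto simp: relpowp_Suc_left cayley_adj_def relcompp_apply
        simp del: relpowp.simps)
  also have "\<dots> \<longleftrightarrow> (\<exists>s\<in>S. \<exists>w\<in>lists S. length w = n \<and> y = x \<otimes> word_val G (s # w))"
    using Suc by (auto simp: m_assoc)
  also have "\<dots> \<longleftrightarrow> (\<exists>w\<in>lists S. length w = Suc n \<and> y = x \<otimes> word_val G w)"
  proof
    assume "\<exists>s\<in>S. \<exists>w\<in>lists S. length w = n \<and> y = x \<otimes> word_val G (s # w)"
    then obtain s w where "s \<in> S" "w \<in> lists S" "length w = n" "y = x \<otimes> word_val G (s # w)"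
      by blast
    thus "\<exists>w\<in>lists S. length w = Suc n \<and> y = x \<otimes> word_val G w"
      by (intro bexI[of _ "s # w"]) auto
  next
    assume "\<exists>w\<in>lists S. length w = Suc n \<and> y = x \<otimes> word_val G w"
    then obtain w where w: "w \<in> lists S" "length w = Suc n" "y = x \<otimes> word_val G w" by blast
    then obtain s v where "w = s # v" by (cases w) auto
    with w show "\<exists>s\<in>S. \<exists>w\<in>lists S. length w = n \<and> y = x \<otimes> word_val G (s # w)"
      by (intro bexI[of _ s] bexI[of _ v]) auto
  qed
  finally show ?case .
qed auto

text \<open>The distance is the length of \<open>inv x \<otimes> y\<close>, whose inversions are the
  separating walls conjugated by \<open>x\<close>.\<close>

lemma cayley_dist_inversions:
  assumes "x \<in> carrier G" "y \<in> carrier G"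
  shows "cayley_dist G S x y = card (sym_diff (inversions x) (inversions y))"
proof -
  have "y = x \<otimes> word_val G w \<longleftrightarrow> word_val G w = inv x \<otimes> y" if "w \<in> lists S" for w
    using assms that by (metis inv_solve_left word_val_closed)
  hence "(cayley_adj G S ^^ n) x y \<longleftrightarrow> (\<exists>w\<in>lists S. length w = n \<and> word_val G w = inv x \<otimes> y)" for n
    unfolding cayley_adj_pow[OF assms(1)] by blast
  hence "cayley_dist G S x y = cox_length G S (inv x \<otimes> y)"
    by (simp add: cayley_dist_def cox_length_def)
  also have "\<dots> = card (inversions (inv x \<otimes> y))"
    using assms by (simp add: card_inversions)
  also have "inversions (inv x \<otimes> y) = conj_inv x ` sym_diff (inversions x) (inversions y)"
  proof (intro equalityI subsetI)
    fix t assume t: "t \<in> inversions (inv x \<otimes> y)"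
    hence "t \<in> carrier G" using inversions_carrier by blast
    thus "t \<in> conj_inv x ` sym_diff (inversions x) (inversions y)"
      using in_inversions_inv_mult[of x y "conj_inv (inv x) t"] t assms
      by (intro image_eqI[of _ _ "conj_inv (inv x) t"]) auto
  next
    fix t assume "t \<in> conj_inv x ` sym_diff (inversions x) (inversions y)"
    then obtain c where "t = conj_inv x c" "c \<in> sym_diff (inversions x) (inversions y)" by blast
    thus "t \<in> inversions (inv x \<otimes> y)"
      using in_inversions_inv_mult[of x y c] assms inversions_carrier by blast
  qed
  also have "card \<dots> = card (sym_diff (inversions x) (inversions y))"
    using inversions_carrier assms by (intro card_image inj_on_conj_inv) blast+
  finally show ?thesis .
qed

text \<open>If \<open>t\<close> were an inversion of \<open>c\<close> but not of \<open>a\<close> or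
  \<open>b\<close>, a path through \<open>c\<close> would cross the wall of \<open>t\<close> besides
  all walls separating \<open>a\<close> from \<open>b\<close>, so it could not be shortest.\<close>

lemma cayley_convex_halfspace: "cayley_convex G S {x \<in> carrier G. t \<notin> inversions x}"
proof -
  have separate: "t \<notin> inversions c"
    if "a \<in> carrier G" "b \<in> carrier G" "c \<in> carrier G" "t \<notin> inversions a" "t \<notin> inversions b"
      and d: "cayley_dist G S a c + cayley_dist G S c b = cayley_dist G S a b" for a b c
  proof
    assume t: "t \<in> inversions c"
    let ?A = "inversions a" and ?B = "inversions b" and ?C = "inversions c"
    have fin: "finite ?A" "finite ?B" "finite ?C" using that by auto
    have "card (sym_diff ?A ?B) < card (insert t (sym_diff ?A ?B))"
      using that fin by simp
    also have "\<dots> \<le> card (sym_diff ?A ?C \<union> sym_diff ?C ?B)"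
      using that t fin by (intro card_mono) auto
    also have "\<dots> \<le> card (sym_diff ?A ?C) + card (sym_diff ?C ?B)"
      by (rule card_Un_le)
    finally show False using d that by (simp add: cayley_dist_inversions)
  qed
  show ?thesis
    unfolding cayley_convex_def
  proof (intro conjI ballI impI CollectI)
    fix a b c
    assume "a \<in> {x \<in> carrier G. t \<notin> inversions x}" "b \<in> {x \<in> carrier G. t \<notin> inversions x}"
      and "c \<in> carrier G" "cayley_dist G S a c + cayley_dist G S c b = cayley_dist G S a b"
    thus "t \<notin> inversions c" using separate[of a b c] by simp
  qed auto
qed

text \<open>If no element of \<open>A\<close> has inversion \<open>t\<close>, then \<open>A\<close>
  lies in the convex half-space avoiding \<open>t\<close>, and so does its hull.\<close>

lemma cayley_conv_inversions:
  assumes "A \<subseteq> carrier G" "x \<in> cayley_conv G S A"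
  shows "x \<in> carrier G" and "inversions x \<subseteq> (\<Union>a\<in>A. inversions a)"
proof -
  have hull: "x \<in> C" if "cayley_convex G S C" "A \<subseteq> C" for C
    using assms(2) that unfolding cayley_conv_def hull_def by blast
  show "x \<in> carrier G"
    using hull[of "carrier G"] assms(1) by (auto simp: cayley_convex_def)
  show "inversions x \<subseteq> (\<Union>a\<in>A. inversions a)"
  proof
    fix t assume "t \<in> inversions x"
    thus "t \<in> (\<Union>a\<in>A. inversions a)"
      using hull[OF cayley_convex_halfspace, of t] assms(1) by blast
  qed
qed

section \<open>Meets in the weak order and the map into the two intervals\<close>

lemma weak_order_le_iff:
  assumes "x \<in> carrier G" "y \<in> carrier G"
  shows "x \<sqsubseteq>\<^bsub>right_weak_order G S\<^esub> y \<longleftrightarrow> inversions x \<subseteq> inversions y"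
proof -
  have "x \<sqsubseteq>\<^bsub>right_weak_order G S\<^esub> y \<longleftrightarrow> (right_weak_cover G S)\<^sup>*\<^sup>* x y"
    by (simp add: right_weak_order_def)
  thus ?thesis
    using weak_order_inversions_mono[of x y] inversions_mono_weak_order[of x y] assms by metis
qed

lemma weak_order_meet:
  assumes x: "x \<in> carrier G" and y: "y \<in> carrier G"
  defines "z \<equiv> x \<sqinter>\<^bsub>right_weak_order G S\<^esub> y"
  shows "is_glb (right_weak_order G S) z {x, y}" and "z \<in> carrier G"
    and "inversions z = inversions x \<inter> inversions y"
proof -
  let ?L = "right_weak_order G S"
  have carrier: "carrier ?L = carrier G" by (simp add: right_weak_order_def)
  have lower: "v \<in> Lower ?L {x, y} \<longleftrightarrow> v \<in> carrier G \<and> inversions v \<subseteq> inversions x \<inter> inversions y" for v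
    using x y weak_order_le_iff[of v x] weak_order_le_iff[of v y]
    by (simp add: Lower_def carrier) blast
  have "Lower ?L {x, y} \<subseteq> carrier ?L" by (rule Lower_closed)
  hence glb_iff: "is_glb ?L w {x, y} \<longleftrightarrow> w \<in> Lower ?L {x, y} \<and> (\<forall>v\<in>Lower ?L {x, y}. v \<sqsubseteq>\<^bsub>?L\<^esub> w)" for w
    by (simp add: greatest_def)
  obtain w where w: "w \<in> carrier G" "inversions w = inversions x \<inter> inversions y"
    using inversions_meet x y by blast
  have wl: "w \<in> Lower ?L {x, y}" using w by (simp add: lower)
  moreover have "v \<sqsubseteq>\<^bsub>?L\<^esub> w" if "v \<in> Lower ?L {x, y}" for v
    using that w weak_order_le_iff[of v w] by (simp add: lower)
  ultimately have "is_glb ?L w {x, y}" by (simp add: glb_iff)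
  \<comment> \<open>The meet is a choice among greatest lower bounds; \<open>w\<close> shows that
    one exists. Below, \<open>w \<sqsubseteq> z\<close> forces the inversions of \<open>z\<close> to
    fill the intersection.\<close>
  thus glb: "is_glb ?L z {x, y}"
    unfolding z_def meet_def inf_def by (rule someI)
  hence z: "z \<in> Lower ?L {x, y}" "w \<sqsubseteq>\<^bsub>?L\<^esub> z"
    using wl by (simp_all add: glb_iff)
  thus "z \<in> carrier G" by (simp add: lower)
  with z show "inversions z = inversions x \<inter> inversions y"
    using w weak_order_le_iff[of w z] by (simp add: lower subset_antisym)
qed

end

theorem theorem5p2:
  fixes W :: "('a, 'b) monoid_scheme" (structure)
    and S :: "'a set" and m :: "'a \<Rightarrow> 'a \<Rightarrow> enat" and u v :: 'a
  assumes "coxeter_system W S m"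
    and "right_angled S m"
    and "u \<in> carrier W" and "v \<in> carrier W"
  shows "(\<forall>x\<in>cayley_conv W S {\<one>, u, v}.
            is_glb (right_weak_order W S) (x \<sqinter>\<^bsub>right_weak_order W S\<^esub> u) {x, u} \<and>
            is_glb (right_weak_order W S) (x \<sqinter>\<^bsub>right_weak_order W S\<^esub> v) {x, v})
       \<and> meet_pair W S u v \<in> cayley_conv W S {\<one>, u, v}
            \<rightarrow> \<lbrace>\<one>..u\<rbrace>\<^bsub>right_weak_order W S\<^esub> \<times> \<lbrace>\<one>..v\<rbrace>\<^bsub>right_weak_order W S\<^esub>
       \<and> inj_on (meet_pair W S u v) (cayley_conv W S {\<one>, u, v})"
proof -
  interpret right_angled_coxeter_system W S m
    using assms(1,2) by (simp add: right_angled_coxeter_system_def right_angled_coxeter_system_axioms_def)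
  let ?L = "right_weak_order W S"
  \<comment> \<open>The identity has no inversions, so only \<open>u\<close> and \<open>v\<close>
    contribute to the union.\<close>
  have conv: "x \<in> carrier W" "inversions x \<subseteq> inversions u \<union> inversions v"
    if "x \<in> cayley_conv W S {\<one>, u, v}" for x
    using cayley_conv_inversions[OF _ that] assms(3,4) by auto
  have interval: "x \<sqinter>\<^bsub>?L\<^esub> y \<in> \<lbrace>\<one>..y\<rbrace>\<^bsub>?L\<^esub>" if "x \<in> carrier W" "y \<in> carrier W" for x y
    using weak_order_meet(2,3)[OF that] that weak_order_le_iff
    by (auto simp: at_least_at_most_def) (simp add: right_weak_order_def)
  have "inj_on (meet_pair W S u v) (cayley_conv W S {\<one>, u, v})"
  proof (rule inj_onI)
    fix x y assume x: "x \<in> cayley_conv W S {\<one>, u, v}" and y: "y \<in> cayley_conv W S {\<one>, u, v}"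
      and eq: "meet_pair W S u v x = meet_pair W S u v y"
    have "inversions x \<inter> inversions w = inversions y \<inter> inversions w" if "w \<in> {u, v}" for w
      using weak_order_meet(3)[of x w] weak_order_meet(3)[of y w] conv(1)[OF x] conv(1)[OF y]
        eq that assms(3,4) by (auto simp: meet_pair_def)
    hence "inversions x = inversions y"
      using conv(2)[OF x] conv(2)[OF y] by blast
    thus "x = y" using inversions_inject conv(1) x y by blast
  qed
  moreover have "meet_pair W S u v \<in> cayley_conv W S {\<one>, u, v} \<rightarrow> \<lbrace>\<one>..u\<rbrace>\<^bsub>?L\<^esub> \<times> \<lbrace>\<one>..v\<rbrace>\<^bsub>?L\<^esub>"
    using interval conv(1) assms(3,4) by (auto simp: meet_pair_def)
  ultimately show ?thesis
    using weak_order_meet(1) conv(1) assms(3,4) by blast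
qed

end
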